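(* Let $B$ be a non-trivial Boolean algebra and let $\mathscr K_{\min}=\{M\subseteq B: M\neq\emptyset \text{ and there is } x\in B\setminus\{0\} \text{ with } x\le m \text{ for all } m\in M\}$. Then $\mathscr K_{\min}$ is an ultracontact on $B$, and $\mathscr K_{\min}\subseteq\mathscr K$ for every ultracontact $\mathscr K$ on $B$.
   Context: Let $B$ be a non-trivial Boolean algebra with order $\le$ and join $+$. For $F,G\subseteq B$ put $F+G=\{f+g: f\in F,\ g\in G\}$, and write $F\preceq G$ iff for every $g\in G$ there is $f\in F$ with $f\le g$. An ultracontact on $B$ is a family $\mathscr K\subseteq 2^B$ such that for all $F,G\subseteq B$: (K0) $\emptyset\notin\mathscr K$; (K1) if $0\in F$ then $F\notin\mathscr K$; (K2) if $x\neq 0$ then $\{x\}\in\mathscr K$; (K3) if $F\preceq G$, $G\neq\emptyset$ and $F\in\mathscr K$, then $G\in\mathscr K$; (K4) if $F+G\in\mathscr K$ then $F\in\mathscr K$ or $G\in\mathscr K$. *)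

theory Defs
  imports Main
begin

text \<open>
  The Boolean algebra \<open>B\<close> is the carrier of a type of class \<open>boolean_algebra\<close>; its join \<open>+\<close> is
  \<^const>\<open>sup\<close> and its zero is \<^const>\<open>bot\<close>. The class admits the one-element algebra.
\<close>

definition set_join :: "'a::boolean_algebra set \<Rightarrow> 'a set \<Rightarrow> 'a set"  (infixl "[+]" 65)
  where "F [+] G = {sup f g | f g. f \<in> F \<and> g \<in> G}"

definition corefines :: "'a::boolean_algebra set \<Rightarrow> 'a set \<Rightarrow> bool"  (infix "[\<preceq>]" 50)
  where "F [\<preceq>] G \<longleftrightarrow> (\<forall>g\<in>G. \<exists>f\<in>F. f \<le> g)"

definition ultracontact :: "'a::boolean_algebra set set \<Rightarrow> bool"
  where "ultracontact K \<longleftrightarrow>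
    {} \<notin> K \<and>
    (\<forall>F. bot \<in> F \<longrightarrow> F \<notin> K) \<and>
    (\<forall>x. x \<noteq> bot \<longrightarrow> {x} \<in> K) \<and>
    (\<forall>F G. F [\<preceq>] G \<and> G \<noteq> {} \<and> F \<in> K \<longrightarrow> G \<in> K) \<and>
    (\<forall>F G. F [+] G \<in> K \<longrightarrow> F \<in> K \<or> G \<in> K)"

definition K_min :: "'a::boolean_algebra set set"
  where "K_min = {M. M \<noteq> {} \<and> (\<exists>x. x \<noteq> bot \<and> (\<forall>m\<in>M. x \<le> m))}"

end

theory Submission
  imports Defs
begin

lemma K_min_nonempty: "M \<in> K_min \<Longrightarrow> M \<noteq> {}"
  by (simp add: K_min_def)

lemma bot_notin_K_min: "bot \<in> M \<Longrightarrow> M \<notin> K_min"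
  by (auto simp: K_min_def dest: bspec bot.extremum_uniqueI)

lemma singleton_in_K_min: "x \<noteq> bot \<Longrightarrow> {x} \<in> K_min"
  by (auto simp: K_min_def)

text \<open>Each element of \<open>G\<close> lies above some element of \<open>F\<close>, so a
  nonzero lower bound of \<open>F\<close> also bounds \<open>G\<close> from below.\<close>

lemma K_min_corefines:
  assumes "F [\<preceq>] G" "G \<noteq> {}" "F \<in> K_min"
  shows "G \<in> K_min"
  using assms unfolding K_min_def corefines_def by (blast intro: order_trans)

text \<open>
  If a lower bound \<open>x\<close> of \<open>F [+] G\<close> is not below some \<open>f \<in> F\<close>, then the nonzero
  element \<open>inf x (- f)\<close> is a lower bound of \<open>G\<close>.
\<close>
lemma K_min_set_join:
  assumes "F [+] G \<in> K_min"
  shows "F \<in> K_min \<or> G \<in> K_min"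
proof -
  obtain x where ne: "F [+] G \<noteq> {}" and x: "x \<noteq> bot"
    and le: "\<And>f g. f \<in> F \<Longrightarrow> g \<in> G \<Longrightarrow> x \<le> sup f g"
    using assms by (fastforce simp: K_min_def set_join_def)
  have FG: "F \<noteq> {}" "G \<noteq> {}"
    using ne by (auto simp: set_join_def)
  show ?thesis
  proof (cases "\<forall>f\<in>F. x \<le> f")
    case True
    then show ?thesis
      using FG x by (auto simp: K_min_def)
  next
    case False
    then obtain f where f: "f \<in> F" "\<not> x \<le> f"
      by blast
    \<comment> \<open>The meet \<open>inf x (- f)\<close> vanishes exactly when
      \<open>x \<le> f\<close>.\<close>
    have "inf x (- f) \<noteq> bot"
      using f(2) by (simp add: inf_shunt)
    \<comment> \<open>Shunting \<open>f\<close> to the left of \<open>x \<le> sup f g\<close> gives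
      this bound.\<close>
    moreover have "inf x (- f) \<le> g" if "g \<in> G" for g
      using le[OF f(1) that] by (metis double_compl inf_commute shunt1)
    ultimately show ?thesis
      using FG(2) by (auto simp: K_min_def)
  qed
qed

lemma ultracontact_K_min: "ultracontact K_min"
  unfolding ultracontact_def
  using K_min_nonempty bot_notin_K_min singleton_in_K_min K_min_corefines K_min_set_join
  by metis

text \<open>A nonzero lower bound \<open>x\<close> of \<open>M\<close> satisfies
  \<open>{x} [\<preceq>] M\<close>. The singleton axiom puts \<open>{x}\<close> into
  \<open>K\<close>, and closure of \<open>K\<close> along \<open>[\<preceq>]\<close> carries
  membership over to the nonempty set \<open>M\<close>.\<close>

lemma K_min_least:
  assumes "ultracontact K"
  shows "K_min \<subseteq> K"
proof
  fix M :: "'a set"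
  assume "M \<in> K_min"
  then obtain x where "M \<noteq> {}" "x \<noteq> bot" "{x} [\<preceq>] M"
    by (auto simp: K_min_def corefines_def)
  then show "M \<in> K"
    using assms unfolding ultracontact_def by metis
qed

theorem theorem4p4:
  assumes nontrivial: "(bot :: 'a::boolean_algebra) \<noteq> top"
  shows "ultracontact (K_min :: 'a set set) \<and>
    (\<forall>K :: 'a set set. ultracontact K \<longrightarrow> K_min \<subseteq> K)"
  by (simp add: ultracontact_K_min K_min_least)

end
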